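(* Let $d\ge 2$ and let $H(z)=(H_1(z),\dots,H_n(z))\in\mathbb{C}[z]^{\times n}$ be homogeneous of degree $d$. Let $G(z)=z+\sum_{m=1}^\infty N_{[m]}(z)$ be the formal inverse of $F(z)=z-H(z)$, where $N_{[m]}(z)$ is homogeneous of degree $m(d-1)+1$ for each $m\ge 1$, and set $N_{[0]}(z)=z$. Then $$N_{[1]}(z)=H(z),\qquad N_{[m+1]}(z)=\sum_{\substack{k_1+\cdots+k_d=m\\ k_i\ge 0}}B\big(N_{[k_1]},N_{[k_2]},\dots,N_{[k_d]}\big)\quad\text{for any } m\ge 1,$$ where $B=(B_1,\dots,B_n)$ is the symmetric $d$-linear form associated with $H$.
   Context: $z=(z_1,\dots,z_n)$. A vector of polynomials is homogeneous of degree $e$ if each component is homogeneous of degree $e$ (zero allowed). The formal inverse $G$ of $F$ is the formal map with $F(G(z))=G(F(z))=z$; when $H$ is homogeneous of degree $d\geq 2$, its homogeneous components occur only in degrees $m(d-1)+1$, $m\ge 0$, and $N_{[m]}$ ($m\ge1$) denotes the component of degree $m(d-1)+1$. Definition of $B$: for $1\le j\le d$ let $U^{(j)}=(U^{(j)}_1,\dots,U^{(j)}_n)$ be vectors of formal variables and $D^{(j)}=\sum_{k=1}^n U^{(j)}_k\frac{\partial}{\partial z_k}$ (the $U^{(j)}_k$ being treated as constants under differentiation in $z$). For $1\le i\le n$ define the symmetric $d$-linear form $$B_i(U^{(1)},\dots,U^{(d)})=\frac{1}{d!}D^{(1)}D^{(2)}\cdots D^{(d)}H_i(z),$$ and set $B=(B_1,\dots,B_n)$;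 vectors of series or polynomials may be substituted for the $U^{(j)}$. *)

theory Defs
  imports Complex_Main "HOL-Library.Poly_Mapping" "HOL-Library.FuncSet"
begin

type_synonym 'v monom = "'v \<Rightarrow>\<^sub>0 nat"

type_synonym ('v, 'a) mpoly = "'v monom \<Rightarrow>\<^sub>0 'a"

definition monom_deg :: "'v monom \<Rightarrow> nat"
  where "monom_deg a = (\<Sum>v\<in>Poly_Mapping.keys a. Poly_Mapping.lookup a v)"

definition monom_eval :: "('v \<Rightarrow> 'r::comm_monoid_mult) \<Rightarrow> 'v monom \<Rightarrow> 'r"
  where "monom_eval V a = (\<Prod>v\<in>Poly_Mapping.keys a. V v ^ Poly_Mapping.lookup a v)"

definition mpoly_const :: "'a \<Rightarrow> ('v, 'a::zero) mpoly"
  where "mpoly_const c = Poly_Mapping.single 0 c"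

definition mpoly_var :: "'v \<Rightarrow> ('v, 'a::{zero,one}) mpoly"
  where "mpoly_var v = Poly_Mapping.single (Poly_Mapping.single v 1) 1"

definition homogeneous :: "nat \<Rightarrow> ('v, 'a::zero) mpoly \<Rightarrow> bool"
  where "homogeneous e p \<longleftrightarrow> (\<forall>a\<in>Poly_Mapping.keys p. monom_deg a = e)"

text \<open>If \<open>v\<close> does not occur in the monomial \<open>a\<close>, the coefficient
  contributed by \<open>a\<close> is \<open>0\<close>, so the truncated subtraction in the exponent is harmless.\<close>

definition mpoly_pderiv :: "'v \<Rightarrow> ('v, 'a::comm_semiring_1) mpoly \<Rightarrow> ('v, 'a) mpoly"
  where "mpoly_pderiv v p =
    (\<Sum>a\<in>Poly_Mapping.keys p.
       Poly_Mapping.single (a - Poly_Mapping.single v 1)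
         (of_nat (Poly_Mapping.lookup a v) * Poly_Mapping.lookup p a))"

definition mpoly_subst ::
    "('v \<Rightarrow> ('w, 'a::comm_ring_1) mpoly) \<Rightarrow> ('v, 'a) mpoly \<Rightarrow> ('w, 'a) mpoly"
  where "mpoly_subst V p =
    (\<Sum>a\<in>Poly_Mapping.keys p. mpoly_const (Poly_Mapping.lookup p a) * monom_eval V a)"

text \<open>The variables \<open>z\<^sub>k\<close> together with the formal variables \<open>U\<^sup>(\<^sup>j\<^sup>)\<^sub>k\<close>.\<close>

datatype 'n bvar = Z 'n | U nat 'n

text \<open>\<open>D\<^sup>(\<^sup>j\<^sup>) = (\<Sum>k. U\<^sup>(\<^sup>j\<^sup>)\<^sub>k \<partial>/\<partial>z\<^sub>k)\<close>\<close>

definition dir_deriv ::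
    "nat \<Rightarrow> ('n::finite bvar, complex) mpoly \<Rightarrow> ('n bvar, complex) mpoly"
  where "dir_deriv j p = (\<Sum>k\<in>UNIV. mpoly_var (U j k) * mpoly_pderiv (Z k) p)"

text \<open>\<open>(1/d!) D\<^sup>(\<^sup>1\<^sup>) \<dots> D\<^sup>(\<^sup>d\<^sup>) h(z)\<close> as a polynomial in the variables \<open>z\<close> and \<open>U\<close>.\<close>

definition polarization ::
    "nat \<Rightarrow> ('n::finite, complex) mpoly \<Rightarrow> ('n bvar, complex) mpoly"
  where "polarization d h =
    mpoly_const (1 / fact d) *
    foldr dir_deriv [1..<Suc d] (mpoly_subst (\<lambda>k. mpoly_var (Z k)) h)"

text \<open>\<open>B\<^sub>i(V\<^sup>(\<^sup>1\<^sup>), \<dots>, V\<^sup>(\<^sup>d\<^sup>))\<close>: substitute the polynomial vectors \<open>V 1, \<dots>, V d\<close> for the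
  formal vectors \<open>U\<^sup>(\<^sup>1\<^sup>), \<dots>, U\<^sup>(\<^sup>d\<^sup>)\<close>.\<close>

definition multilin_form ::
    "nat \<Rightarrow> ('n::finite \<Rightarrow> ('n, complex) mpoly) \<Rightarrow> (nat \<Rightarrow> 'n \<Rightarrow> ('n, complex) mpoly)
      \<Rightarrow> 'n \<Rightarrow> ('n, complex) mpoly"
  where "multilin_form d H V i =
    mpoly_subst (\<lambda>x. case x of Z k \<Rightarrow> mpoly_var k | U j k \<Rightarrow> V j k) (polarization d (H i))"

typedef ('v, 'a) mfps = "UNIV :: ('v monom \<Rightarrow> 'a) set"
  morphisms mfps_nth Abs_mfps
  by simp

setup_lifting type_definition_mfps

lemma mfps_eqI: "(\<And>a. mfps_nth f a = mfps_nth g a) \<Longrightarrow> f = g"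
  by transfer auto

lemma finite_monom_le: "finite {b :: 'v monom. \<forall>v. Poly_Mapping.lookup b v \<le> Poly_Mapping.lookup a v}"
proof -
  let ?S = "{b :: 'v monom. \<forall>v. Poly_Mapping.lookup b v \<le> Poly_Mapping.lookup a v}"
  let ?r = "\<lambda>b :: 'v monom. restrict (Poly_Mapping.lookup b) (Poly_Mapping.keys a)"
  have "inj_on ?r ?S"
  proof (rule inj_onI)
    fix b c assume b: "b \<in> ?S" and c: "c \<in> ?S" and eq: "?r b = ?r c"
    show "b = c"
    proof (rule poly_mapping_eqI)
      fix v
      show "Poly_Mapping.lookup b v = Poly_Mapping.lookup c v"
      proof (cases "v \<in> Poly_Mapping.keys a")
        case True
        then show ?thesis using fun_cong[OF eq, of v] by simp
      next
        case False
        then have "Poly_Mapping.lookup a v = 0" by (simp add: in_keys_iff)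
        then show ?thesis using b c by (metis (mono_tags) le_zero_eq mem_Collect_eq)
      qed
    qed
  qed
  moreover have "?r ` ?S \<subseteq>
      PiE (Poly_Mapping.keys a) (\<lambda>v. {..Poly_Mapping.lookup a v})"
    by auto
  then have "finite (?r ` ?S)"
    by (rule finite_subset) (auto intro: finite_PiE)
  ultimately show ?thesis by (rule finite_imageD[rotated])
qed

lemma finite_monom_splits [simp]: "finite {(b, c). b + c = (a :: 'v monom)}"
proof (rule finite_subset)
  let ?S = "{b :: 'v monom. \<forall>v. Poly_Mapping.lookup b v \<le> Poly_Mapping.lookup a v}"
  show "{(b, c). b + c = a} \<subseteq> ?S \<times> ?S"
    by (auto simp: lookup_add)
  show "finite (?S \<times> ?S)" by (intro finite_cartesian_product finite_monom_le)
qed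

lemmas finite_monom_splits' [simp] = finite_monom_splits[unfolded case_prod_unfold]

instantiation mfps :: (type, comm_ring_1) comm_ring_1
begin

lift_definition zero_mfps :: "('a, 'b) mfps" is "\<lambda>_. 0" .
lift_definition one_mfps :: "('a, 'b) mfps" is "\<lambda>a. if a = 0 then 1 else 0" .
lift_definition plus_mfps :: "('a, 'b) mfps \<Rightarrow> ('a, 'b) mfps \<Rightarrow> ('a, 'b) mfps"
  is "\<lambda>f g a. f a + g a" .
lift_definition minus_mfps :: "('a, 'b) mfps \<Rightarrow> ('a, 'b) mfps \<Rightarrow> ('a, 'b) mfps"
  is "\<lambda>f g a. f a - g a" .
lift_definition uminus_mfps :: "('a, 'b) mfps \<Rightarrow> ('a, 'b) mfps"
  is "\<lambda>f a. - f a" .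
lift_definition times_mfps :: "('a, 'b) mfps \<Rightarrow> ('a, 'b) mfps \<Rightarrow> ('a, 'b) mfps"
  is "\<lambda>f g a. \<Sum>(b, c) | b + c = a. f b * g c" .

instance
proof
  fix f g h :: "('a, 'b) mfps"
  show "f + g + h = f + (g + h)" by transfer (simp add: add.assoc)
  show "f + g = g + f" by transfer (simp add: add.commute)
  show "0 + f = f" by transfer simp
  show "- f + f = 0" by transfer simp
  show "f - g = f + - g" by transfer simp
  show "(0 :: ('a, 'b) mfps) \<noteq> 1" by transfer (auto simp: fun_eq_iff)
  show "(f + g) * h = f * h + g * h"
    by transfer (simp add: fun_eq_iff algebra_simps sum.distrib case_prod_unfold)
  show "f * g = g * f"
  proof (transfer, rule ext)
    fix f g :: "'a monom \<Rightarrow> 'b" and a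
    show "(\<Sum>(b, c) | b + c = a. f b * g c) = (\<Sum>(b, c) | b + c = a. g b * f c)"
      by (rule sum.reindex_bij_witness[of _ prod.swap prod.swap])
         (auto simp: add.commute mult.commute)
  qed
  show "1 * f = f"
  proof (transfer, rule ext)
    fix f :: "'a monom \<Rightarrow> 'b" and a
    have "(\<Sum>(b, c) | b + c = a. (if b = 0 then 1 else 0) * f c) =
        (\<Sum>(b, c)\<in>{(0 :: 'a monom, a)}. (if b = 0 then 1 else 0) * f c)"
      by (rule sum.mono_neutral_right) (auto split: if_splits)
    then show "(\<Sum>(b, c) | b + c = a. (if b = 0 then 1 else 0) * f c) = f a" by simp
  qed
  show "f * g * h = f * (g * h)"
  proof (transfer, rule ext)
    fix f g h :: "'a monom \<Rightarrow> 'b" and a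
    have "(\<Sum>(b, c) | b + c = a. (\<Sum>(p, q) | p + q = b. f p * g q) * h c) =
        (\<Sum>((b, c), (p, q)) \<in> (SIGMA x : {(b, c). b + c = a}. {(p, q). p + q = fst x}).
           f p * g q * h c)"
      by (subst sum.Sigma[symmetric])
         (auto simp: sum_distrib_right case_prod_unfold intro!: sum.cong)
    also have "\<dots> =
        (\<Sum>((b, c), (p, q)) \<in> (SIGMA x : {(b, c). b + c = a}. {(p, q). p + q = snd x}).
           f b * (g p * h q))"
      by (rule sum.reindex_bij_witness[of _
            "\<lambda>((b, c), (p, q)). ((b + p, q), (b, p))"
            "\<lambda>((b, c), (p, q)). ((p, q + c), (q, c))"])
         (auto simp: add.assoc mult.assoc)
    also have "\<dots> = (\<Sum>(b, c) | b + c = a. f b * (\<Sum>(p, q) | p + q = c. g p * h q))"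
      by (subst sum.Sigma[symmetric])
         (auto simp: sum_distrib_left case_prod_unfold intro!: sum.cong)
    finally show "(\<Sum>(b, c) | b + c = a. (\<Sum>(p, q) | p + q = b. f p * g q) * h c) =
        (\<Sum>(b, c) | b + c = a. f b * (\<Sum>(p, q) | p + q = c. g p * h q))" .
  qed
qed

end

definition mfps_of_mpoly :: "('v, 'a::zero) mpoly \<Rightarrow> ('v, 'a) mfps"
  where "mfps_of_mpoly p = Abs_mfps (Poly_Mapping.lookup p)"

definition mfps_var :: "'v \<Rightarrow> ('v, 'a::{zero,one}) mfps"
  where "mfps_var v = mfps_of_mpoly (mpoly_var v)"

text \<open>Infinite sums of series are taken coefficientwise. \<^const>\<open>Sum_any\<close> is the sum over
  the support of its argument; it is meaningful here when, for every monomial, only finitely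
  many summands have a nonzero coefficient.\<close>

definition mfps_suminf :: "(nat \<Rightarrow> ('v, 'a::comm_monoid_add) mfps) \<Rightarrow> ('v, 'a) mfps"
  where "mfps_suminf f = Abs_mfps (\<lambda>a. Sum_any (\<lambda>m. mfps_nth (f m) a))"

text \<open>\<open>f(g) = (\<Sum>a. f\<^sub>a g\<^sup>a)\<close>, again coefficientwise. In finitely many variables the sum is
  locally finite as soon as every \<open>g v\<close> has zero constant term.\<close>

definition mfps_compose ::
    "('v, 'a::comm_ring_1) mfps \<Rightarrow> ('v \<Rightarrow> ('w, 'a) mfps) \<Rightarrow> ('w, 'a) mfps"
  where "mfps_compose f g =
    Abs_mfps (\<lambda>c. Sum_any (\<lambda>a. mfps_nth f a * mfps_nth (monom_eval g a) c))"

definition is_formal_inverse ::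
    "('n::finite \<Rightarrow> ('n, 'a::comm_ring_1) mfps) \<Rightarrow> ('n \<Rightarrow> ('n, 'a) mfps) \<Rightarrow> bool"
  where "is_formal_inverse F G \<longleftrightarrow>
    (\<forall>i. mfps_nth (F i) 0 = 0) \<and> (\<forall>i. mfps_nth (G i) 0 = 0) \<and>
    (\<forall>i. mfps_compose (F i) G = mfps_var i) \<and>
    (\<forall>i. mfps_compose (G i) F = mfps_var i)"

end

theory Submission
  imports Defs
begin

text \<open>
  The equation \<open>F(G(z)) = z\<close> for \<open>F = z - H\<close> says that \<open>G\<close> is a fixed point:
  \<open>G = z + H(G)\<close> (lemma \<open>formal_inverse_fixed_point\<close>). The recursion is the homogeneous
  component of degree \<open>(m + 1)(d - 1) + 1\<close> of this equation, once the right-hand side is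
  written through the polar form of \<open>H\<close>.

  Polarization. For homogeneous \<open>h\<close> of degree \<open>d\<close> the \<open>d\<close>-fold partial derivatives
  \<open>\<partial>\<^bsub>f(1)\<^esub> \<dots> \<partial>\<^bsub>f(d)\<^esub> h\<close> are constants \<open>d! c\<^sub>f\<close>, one for each map \<open>f\<close> from \<open>{1..d}\<close> to the
  variables. Expanding the operators \<open>D\<^sup>(\<^sup>j\<^sup>)\<close> gives
  \<open>B(V\<^sup>(\<^sup>1\<^sup>), \<dots>, V\<^sup>(\<^sup>d\<^sup>)) = \<Sum>\<^sub>f c\<^sub>f \<Prod>\<^sub>j V\<^sup>(\<^sup>j\<^sup>)\<^bsub>f(j)\<^esub>\<close> (lemma \<open>multilin_form_expansion\<close>), which
  is visibly \<open>d\<close>-linear and homogeneous. Applying Euler's identity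
  \<open>\<Sum>\<^sub>k z\<^sub>k \<partial>\<^sub>k h = d h\<close> repeatedly, for degrees \<open>d, d - 1, \<dots>, 1\<close>, gives the same expansion
  for \<open>h\<close> itself, \<open>h(V) = \<Sum>\<^sub>f c\<^sub>f \<Prod>\<^sub>j V\<^bsub>f(j)\<^esub>\<close> (lemma \<open>eval_homogeneous_polar\<close>); this holds for
  arguments \<open>V\<close> in any commutative ring over the coefficients, hence for polynomials and for
  power series alike.

  Truncation. To find the coefficients of \<open>H(G)\<close> in degree \<open>(m + 1)(d - 1) + 1\<close>, the series
  \<open>G\<close> may be replaced by the polynomial vector \<open>P = N\<^sub>0 + \<dots> + N\<^sub>m\<close>: the difference
  \<open>G - P\<close> has no terms below degree \<open>(m + 1)(d - 1) + 1\<close>, and in \<open>\<Prod>\<^sub>j G\<^bsub>f(j)\<^esub> - \<Prod>\<^sub>j P\<^bsub>f(j)\<^esub>\<close> it is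
  multiplied by \<open>d - 1 \<ge> 1\<close> further factors without constant term (lemma \<open>eval_truncation\<close>).
  Now \<open>H(P) = B(P, \<dots>, P) = \<Sum>\<^sub>k B(N\<^bsub>k(1)\<^esub>, \<dots>, N\<^bsub>k(d)\<^esub>)\<close> is a finite sum of
  homogeneous polynomials of degrees \<open>(k(1) + \<dots> + k(d))(d - 1) + d\<close>, and this degree is
  \<open>(m + 1)(d - 1) + 1\<close> exactly when \<open>k(1) + \<dots> + k(d) = m\<close>. The same argument for
  \<open>m = 0\<close> yields \<open>N\<^sub>1 = B(z, \<dots>, z) = H\<close>.
\<close>

section \<open>Monomials and polynomials\<close>

text \<open>
  Additive maps are determined by their values on single terms. The rule is stated for arbitrary
  finitely supported functions so that it serves for monomials (as sums of powers of one
  variable) as well as for polynomials.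
\<close>

lemma mpoly_sum_induct [case_names single add]:
  assumes single: "\<And>a c. P (Poly_Mapping.single a c)"
    and add: "\<And>f g. P f \<Longrightarrow> P g \<Longrightarrow> P (f + g)"
  shows "P (f :: 'k \<Rightarrow>\<^sub>0 'b::comm_monoid_add)"
proof (induction f rule: update_induct)
  case const
  then show ?case using single[of undefined 0] by simp
next
  case (update f a b)
  have "Poly_Mapping.update a b f = f + Poly_Mapping.single a b"
    using update(1)
    by (intro poly_mapping_eqI)
      (auto simp: lookup_update lookup_add lookup_single in_keys_iff)
  then show ?case using update single add by simp
qed

lemma monom_deg_superset:
  assumes "finite S" "Poly_Mapping.keys a \<subseteq> S"
  shows "monom_deg a = (\<Sum>v\<in>S. Poly_Mapping.lookup a v)"
  unfolding monom_deg_def using assms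
  by (intro sum.mono_neutral_left) (auto simp: in_keys_iff)

lemma monom_deg_add [simp]: "monom_deg (a + b) = monom_deg a + monom_deg b"
proof -
  let ?S = "Poly_Mapping.keys a \<union> Poly_Mapping.keys b"
  have "Poly_Mapping.keys (a + b) \<subseteq> ?S" by (rule keys_add)
  then show ?thesis
    by (subst (1 2 3) monom_deg_superset[of ?S]) (auto simp: lookup_add sum.distrib)
qed

lemma monom_deg_0 [simp]: "monom_deg 0 = 0"
  by (simp add: monom_deg_def)

lemma monom_deg_single [simp]: "monom_deg (Poly_Mapping.single v n) = n"
  by (subst monom_deg_superset[of "{v}"]) auto

lemma monom_deg_eq_0_iff [simp]: "monom_deg a = 0 \<longleftrightarrow> a = 0"
  by (auto simp: monom_deg_def in_keys_iff) (metis keys_eq_empty not_in_keys_iff_lookup_eq_zero equals0I)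

lemma monom_eval_superset:
  assumes "finite S" "Poly_Mapping.keys a \<subseteq> S"
  shows "monom_eval V a = (\<Prod>v\<in>S. V v ^ Poly_Mapping.lookup a v)"
  unfolding monom_eval_def using assms
  by (intro prod.mono_neutral_left) (auto simp: in_keys_iff)

lemma monom_eval_add: "monom_eval V (a + b) = monom_eval V a * monom_eval V b"
proof -
  let ?S = "Poly_Mapping.keys a \<union> Poly_Mapping.keys b"
  have "Poly_Mapping.keys (a + b) \<subseteq> ?S" by (rule keys_add)
  then show ?thesis
    by (subst (1 2 3) monom_eval_superset[of ?S])
      (auto simp: lookup_add power_add prod.distrib)
qed

lemma monom_eval_0 [simp]: "monom_eval V 0 = 1"
  by (simp add: monom_eval_def)

lemma monom_eval_single [simp]: "monom_eval V (Poly_Mapping.single v n) = V v ^ n"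
  by (subst monom_eval_superset[of "{v}"]) auto

lemma mpoly_const_add: "mpoly_const (a + b) = mpoly_const a + mpoly_const b"
  by (simp add: mpoly_const_def single_add)

lemma mpoly_const_mult: "mpoly_const (a * b) = mpoly_const a * mpoly_const b"
  by (simp add: mpoly_const_def mult_single)

lemma mpoly_const_1: "mpoly_const 1 = 1"
  by (simp add: mpoly_const_def)

text \<open>
  The constants and the variables generate the polynomial ring, so identities between ring
  homomorphisms, or between derivations, need only be checked on these.
\<close>

lemma mpoly_ring_induct [case_names const var add mult]:
  fixes p :: "('v, 'a::comm_ring_1) mpoly"
  assumes const: "\<And>c. P (mpoly_const c)"
    and var: "\<And>v. P (mpoly_var v)"
    and add: "\<And>p q. P p \<Longrightarrow> P q \<Longrightarrow> P (p + q)"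
    and mult: "\<And>p q. P p \<Longrightarrow> P q \<Longrightarrow> P (p * q)"
  shows "P p"
proof (induction p rule: mpoly_sum_induct)
  case (single a c)
  have "P (Poly_Mapping.single a 1)"
  proof (induction a rule: mpoly_sum_induct)
    case (single v n)
    show ?case
    proof (induction n)
      case 0
      then show ?case using const[of 1] by (simp add: mpoly_const_1)
    next
      case (Suc n)
      have "Poly_Mapping.single (Poly_Mapping.single v (Suc n)) 1 =
          mpoly_var v * Poly_Mapping.single (Poly_Mapping.single v n) (1 :: 'a)"
        by (simp add: mpoly_var_def mult_single flip: single_add)
      then show ?case using mult[OF var Suc] by simp
    qed
  next
    case (add a b)
    then show ?case using mult[OF add] by (simp add: mult_single)
  qed
  from mult[OF const this, of c] show ?case by (simp add: mpoly_const_def mult_single)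
qed (rule add)

section \<open>Partial derivatives\<close>

lemma mpoly_pderiv_superset:
  assumes "finite S" "Poly_Mapping.keys p \<subseteq> S"
  shows "mpoly_pderiv v p = (\<Sum>a\<in>S.
       Poly_Mapping.single (a - Poly_Mapping.single v 1)
         (of_nat (Poly_Mapping.lookup a v) * Poly_Mapping.lookup p a))"
  unfolding mpoly_pderiv_def using assms
  by (intro sum.mono_neutral_left) (auto simp: in_keys_iff)

lemma mpoly_pderiv_single:
  "mpoly_pderiv v (Poly_Mapping.single a c) =
    Poly_Mapping.single (a - Poly_Mapping.single v 1) (of_nat (Poly_Mapping.lookup a v) * c)"
  by (subst mpoly_pderiv_superset[of "{a}"]) auto

lemma mpoly_pderiv_0 [simp]: "mpoly_pderiv v 0 = 0"
  by (simp add: mpoly_pderiv_def)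

lemma mpoly_pderiv_add: "mpoly_pderiv v (p + q) = mpoly_pderiv v p + mpoly_pderiv v q"
proof -
  let ?S = "Poly_Mapping.keys p \<union> Poly_Mapping.keys q"
  have "Poly_Mapping.keys (p + q) \<subseteq> ?S" by (rule keys_add)
  then show ?thesis
    by (subst (1 2 3) mpoly_pderiv_superset[of ?S])
      (auto simp: lookup_add single_add sum.distrib distrib_left)
qed

lemma mpoly_pderiv_sum: "mpoly_pderiv v (\<Sum>x\<in>S. f x) = (\<Sum>x\<in>S. mpoly_pderiv v (f x))"
  by (induction S rule: infinite_finite_induct) (auto simp: mpoly_pderiv_add)

lemma mpoly_pderiv_const [simp]: "mpoly_pderiv v (mpoly_const c) = 0"
  by (simp add: mpoly_const_def mpoly_pderiv_single)

lemma mpoly_pderiv_var: "mpoly_pderiv v (mpoly_var w) = (if v = w then 1 else 0)"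
  by (auto simp: mpoly_var_def mpoly_pderiv_single lookup_single)

text \<open>
  Both sides are biadditive, so it suffices to take two single terms \<open>c z\<^sup>a\<close> and \<open>c' z\<^sup>b\<close>.
  The only delicate point is the truncated subtraction in the exponents: the shifts
  \<open>(a + b) - e\<^sub>v = (a - e\<^sub>v) + b\<close> and \<open>(a + b) - e\<^sub>v = a + (b - e\<^sub>v)\<close> can fail only
  when the coefficient \<open>a\<^sub>v\<close>, respectively \<open>b\<^sub>v\<close>, in front of the term is \<open>0\<close>.
\<close>

lemma mpoly_pderiv_mult:
  fixes p q :: "('v, 'a::comm_ring_1) mpoly"
  shows "mpoly_pderiv v (p * q) = mpoly_pderiv v p * q + p * mpoly_pderiv v q"
proof (induction p rule: mpoly_sum_induct)
  case (single a c)
  show ?case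
  proof (induction q rule: mpoly_sum_induct)
    case (single b c')
    let ?e = "Poly_Mapping.single v (1::nat)"
    let ?a = "Poly_Mapping.lookup a v" and ?b = "Poly_Mapping.lookup b v"
    have 1: "Poly_Mapping.single (a + b - ?e) (of_nat ?a * (c * c')) =
        Poly_Mapping.single (a - ?e + b) (of_nat ?a * (c * c'))"
      if "?a \<noteq> 0"
    proof -
      have "a + b - ?e = a - ?e + b"
        using that by (intro poly_mapping_eqI) (auto simp: lookup_add lookup_minus lookup_single when_def)
      then show ?thesis by simp
    qed
    have 2: "Poly_Mapping.single (a + b - ?e) (of_nat ?b * (c * c')) =
        Poly_Mapping.single (a + (b - ?e)) (of_nat ?b * (c * c'))"
      if "?b \<noteq> 0"
    proof -
      have "a + b - ?e = a + (b - ?e)"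
        using that by (intro poly_mapping_eqI) (auto simp: lookup_add lookup_minus lookup_single when_def)
      then show ?thesis by simp
    qed
    have "mpoly_pderiv v (Poly_Mapping.single a c * Poly_Mapping.single b c') =
        Poly_Mapping.single (a + b - ?e) (of_nat ?a * (c * c')) +
        Poly_Mapping.single (a + b - ?e) (of_nat ?b * (c * c'))"
      by (simp add: mult_single mpoly_pderiv_single lookup_add distrib_right flip: single_add)
    also have "\<dots> = Poly_Mapping.single (a - ?e + b) (of_nat ?a * (c * c')) +
        Poly_Mapping.single (a + (b - ?e)) (of_nat ?b * (c * c'))"
      using 1 2 by (cases "?a = 0"; cases "?b = 0") auto
    also have "\<dots> = mpoly_pderiv v (Poly_Mapping.single a c) * Poly_Mapping.single b c' +
        Poly_Mapping.single a c * mpoly_pderiv v (Poly_Mapping.single b c')"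
      unfolding mult_single mpoly_pderiv_single by (simp add: mult_ac)
    finally show ?case .
  next
    case (add f g)
    then show ?case by (simp add: mpoly_pderiv_add distrib_left algebra_simps)
  qed
next
  case (add f g)
  then show ?case by (simp add: mpoly_pderiv_add distrib_right algebra_simps)
qed

lemma mpoly_pderiv_const_prod:
  fixes P :: "'j \<Rightarrow> ('v, 'a::comm_ring_1) mpoly"
  assumes "\<And>j. j \<in> J \<Longrightarrow> mpoly_pderiv v (P j) = 0"
  shows "mpoly_pderiv v (\<Prod>j\<in>J. P j) = 0"
  using assms
proof (induction J rule: infinite_finite_induct)
  case (infinite A)
  then show ?case using mpoly_pderiv_const[of v "1::'a"] by (simp add: mpoly_const_1)
next
  case empty
  then show ?case using mpoly_pderiv_const[of v "1::'a"] by (simp add: mpoly_const_1)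
next
  case (insert x F)
  then show ?case by (simp add: mpoly_pderiv_mult)
qed

section \<open>Homogeneous polynomials\<close>

lemma homogeneous_add: "homogeneous e p \<Longrightarrow> homogeneous e q \<Longrightarrow> homogeneous e (p + q)"
  unfolding homogeneous_def using keys_add[of p q] by auto

lemma homogeneous_0 [simp]: "homogeneous e 0"
  by (simp add: homogeneous_def)

lemma homogeneous_sum: "(\<And>x. x \<in> S \<Longrightarrow> homogeneous e (f x)) \<Longrightarrow> homogeneous e (\<Sum>x\<in>S. f x)"
  by (induction S rule: infinite_finite_induct) (auto simp: homogeneous_add)

lemma homogeneous_mult:
  assumes "homogeneous d p" "homogeneous e q"
  shows "homogeneous (d + e) (p * q)"
  using assms keys_mult[of p q] unfolding homogeneous_def
  by (fastforce)

lemma homogeneous_const [simp]: "homogeneous 0 (mpoly_const c)"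
  by (auto simp: homogeneous_def mpoly_const_def)

lemma homogeneous_var [simp]: "homogeneous 1 (mpoly_var v)"
  by (auto simp: homogeneous_def mpoly_var_def)

lemma homogeneous_prod:
  fixes P :: "'j \<Rightarrow> ('v, 'a::comm_ring_1) mpoly"
  assumes "\<And>j. j \<in> J \<Longrightarrow> homogeneous (e j) (P j)"
  shows "homogeneous (\<Sum>j\<in>J. e j) (\<Prod>j\<in>J. P j)"
  using assms homogeneous_const[of "1::'a"]
  by (induction J rule: infinite_finite_induct)
    (auto simp: mpoly_const_1 homogeneous_mult)

lemma homogeneous_lookup: "homogeneous e p \<Longrightarrow> monom_deg a \<noteq> e \<Longrightarrow> Poly_Mapping.lookup p a = 0"
  by (auto simp: homogeneous_def in_keys_iff)

lemma homogeneous_0_const: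
  assumes "homogeneous 0 p"
  shows "p = mpoly_const (Poly_Mapping.lookup p 0)"
  using homogeneous_lookup[OF assms]
  by (intro poly_mapping_eqI) (auto simp: mpoly_const_def lookup_single when_def)

lemma homogeneous_pderiv:
  assumes "homogeneous (Suc e) p"
  shows "homogeneous e (mpoly_pderiv v p)"
  unfolding mpoly_pderiv_def
proof (rule homogeneous_sum)
  fix a assume a: "a \<in> Poly_Mapping.keys p"
  show "homogeneous e (Poly_Mapping.single (a - Poly_Mapping.single v 1)
      (of_nat (Poly_Mapping.lookup a v) * Poly_Mapping.lookup p a))"
  proof (cases "Poly_Mapping.lookup a v = 0")
    case False
    then have "(a - Poly_Mapping.single v 1) + Poly_Mapping.single v 1 = a"
      by (intro poly_mapping_eqI) (auto simp: lookup_add lookup_minus lookup_single when_def)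
    then have "monom_deg (a - Poly_Mapping.single v 1) + 1 = monom_deg a"
      by (metis monom_deg_add monom_deg_single)
    then show ?thesis using a assms by (auto simp: homogeneous_def)
  qed auto
qed

section \<open>Evaluation in a ring and Euler's identity\<close>

text \<open>
  A homomorphism on coefficients extends to polynomials as soon as values for the variables are
  chosen. Two instances matter: the target may be a polynomial ring (substitution of
  polynomials) or a ring of power series (substitution of series), and the polarization
  identities below are needed in both.
\<close>

locale coeff_hom =
  fixes \<phi> :: "'a::comm_ring_1 \<Rightarrow> 'r::comm_ring_1"
  assumes hom_add: "\<phi> (x + y) = \<phi> x + \<phi> y"
    and hom_mult: "\<phi> (x * y) = \<phi> x * \<phi> y"
    and hom_1: "\<phi> 1 = 1"
begin

lemma hom_0: "\<phi> 0 = 0"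
  using hom_add[of 0 0] by simp

lemma hom_of_nat: "\<phi> (of_nat n) = of_nat n"
  by (induction n) (auto simp: hom_0 hom_1 hom_add)

definition mpoly_eval :: "('v \<Rightarrow> 'r) \<Rightarrow> ('v, 'a) mpoly \<Rightarrow> 'r"
  where "mpoly_eval V p = (\<Sum>a\<in>Poly_Mapping.keys p. \<phi> (Poly_Mapping.lookup p a) * monom_eval V a)"

lemma eval_superset:
  assumes "finite S" "Poly_Mapping.keys p \<subseteq> S"
  shows "mpoly_eval V p = (\<Sum>a\<in>S. \<phi> (Poly_Mapping.lookup p a) * monom_eval V a)"
  unfolding mpoly_eval_def using assms
  by (intro sum.mono_neutral_left) (auto simp: in_keys_iff hom_0)

lemma eval_single: "mpoly_eval V (Poly_Mapping.single a c) = \<phi> c * monom_eval V a"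
  by (subst eval_superset[of "{a}"]) auto

lemma eval_const [simp]: "mpoly_eval V (mpoly_const c) = \<phi> c"
  by (simp add: mpoly_const_def eval_single)

lemma eval_var [simp]: "mpoly_eval V (mpoly_var v) = V v"
  by (simp add: mpoly_var_def eval_single hom_1)

lemma eval_0 [simp]: "mpoly_eval V 0 = 0"
  by (simp add: mpoly_eval_def)

lemma eval_1 [simp]: "mpoly_eval V 1 = 1"
  using eval_const[of V 1] by (simp add: mpoly_const_1 hom_1)

lemma eval_add: "mpoly_eval V (p + q) = mpoly_eval V p + mpoly_eval V q"
proof -
  let ?S = "Poly_Mapping.keys p \<union> Poly_Mapping.keys q"
  have "Poly_Mapping.keys (p + q) \<subseteq> ?S" by (rule keys_add)
  then show ?thesis
    by (subst (1 2 3) eval_superset[of ?S])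
      (auto simp: lookup_add hom_add sum.distrib distrib_right)
qed

lemma eval_diff: "mpoly_eval V (p - q) = mpoly_eval V p - mpoly_eval V q"
  using eval_add[of V "p - q" q] by (simp add: algebra_simps)

lemma eval_sum: "mpoly_eval V (\<Sum>x\<in>S. f x) = (\<Sum>x\<in>S. mpoly_eval V (f x))"
  by (induction S rule: infinite_finite_induct) (auto simp: eval_add)

lemma eval_mult: "mpoly_eval V (p * q) = mpoly_eval V p * mpoly_eval V q"
proof (induction p rule: mpoly_sum_induct)
  case (single a c)
  show ?case
  proof (induction q rule: mpoly_sum_induct)
    case (single b c')
    then show ?case by (simp add: mult_single eval_single hom_mult monom_eval_add mult_ac)
  qed (simp add: distrib_left eval_add)
qed (simp add: distrib_right eval_add)

lemma eval_prod: "mpoly_eval V (\<Prod>x\<in>S. f x) = (\<Prod>x\<in>S. mpoly_eval V (f x))"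
  by (induction S rule: infinite_finite_induct) (auto simp: eval_mult)

text \<open>
  On a monomial \<open>z\<^sup>a\<close> of degree \<open>e\<close> the left-hand side is \<open>(\<Sum>\<^sub>k a\<^sub>k) z\<^sup>a = e z\<^sup>a\<close>. The identity is
  stated after evaluation because that is how it is iterated.
\<close>

lemma euler:
  fixes p :: "('n::finite, 'a) mpoly"
  assumes "homogeneous e p"
  shows "(\<Sum>k\<in>UNIV. V k * mpoly_eval V (mpoly_pderiv k p)) = of_nat e * mpoly_eval V p"
proof -
  have 1: "V k * (of_nat (Poly_Mapping.lookup a k) * monom_eval V (a - Poly_Mapping.single k 1)) =
      of_nat (Poly_Mapping.lookup a k) * monom_eval V a" for k and a :: "'n monom"
  proof (cases "Poly_Mapping.lookup a k = 0")
    case False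
    then have "(a - Poly_Mapping.single k 1) + Poly_Mapping.single k 1 = a"
      by (intro poly_mapping_eqI) (auto simp: lookup_add lookup_minus lookup_single when_def)
    then have "monom_eval V a = monom_eval V (a - Poly_Mapping.single k 1) * V k"
      by (metis monom_eval_add monom_eval_single power_one_right)
    then show ?thesis by (simp add: mult_ac)
  qed simp
  have "(\<Sum>k\<in>UNIV. V k * mpoly_eval V (mpoly_pderiv k p)) =
      (\<Sum>k\<in>UNIV. \<Sum>a\<in>Poly_Mapping.keys p. \<phi> (Poly_Mapping.lookup p a) *
        (V k * (of_nat (Poly_Mapping.lookup a k) * monom_eval V (a - Poly_Mapping.single k 1))))"
    by (simp add: mpoly_pderiv_def eval_sum eval_single hom_mult hom_of_nat sum_distrib_left mult_ac)
  also have "\<dots> = (\<Sum>a\<in>Poly_Mapping.keys p. \<Sum>k\<in>UNIV. \<phi> (Poly_Mapping.lookup p a) *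
        (of_nat (Poly_Mapping.lookup a k) * monom_eval V a))"
    unfolding 1 by (rule sum.swap)
  also have "\<dots> = (\<Sum>a\<in>Poly_Mapping.keys p. \<phi> (Poly_Mapping.lookup p a) *
        (of_nat (monom_deg a) * monom_eval V a))"
    by (intro sum.cong refl) (simp add: monom_deg_superset[of UNIV] sum_distrib_left sum_distrib_right)
  also have "\<dots> = of_nat e * mpoly_eval V p"
    unfolding mpoly_eval_def sum_distrib_left
    using assms by (intro sum.cong refl) (simp add: homogeneous_def mult_ac)
  finally show ?thesis .
qed

end

lemma coeff_hom_const: "coeff_hom mpoly_const"
  by unfold_locales (auto simp: mpoly_const_add mpoly_const_mult mpoly_const_1)

lemma subst_eval: "coeff_hom.mpoly_eval (mpoly_const :: 'a::comm_ring_1 \<Rightarrow> ('w, 'a) mpoly) = mpoly_subst"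
  by (intro ext) (simp add: coeff_hom.mpoly_eval_def[OF coeff_hom_const] mpoly_subst_def)

interpretation subst: coeff_hom "mpoly_const :: 'a::comm_ring_1 \<Rightarrow> ('w, 'a) mpoly"
  rewrites "coeff_hom.mpoly_eval (mpoly_const :: 'a::comm_ring_1 \<Rightarrow> ('w, 'a) mpoly) = mpoly_subst"
  by (rule coeff_hom_const) (rule subst_eval)

lemma subst_var [simp]: "mpoly_subst mpoly_var p = p"
  by (induction p rule: mpoly_ring_induct) (auto simp: subst.eval_add subst.eval_mult)

section \<open>Iterated derivatives and the polar form\<close>

lemma sum_PiE_insert:
  assumes "j \<notin> S"
  shows "(\<Sum>f\<in>PiE (insert j S) (\<lambda>_. T). g f) =
    (\<Sum>k\<in>T. \<Sum>f\<in>PiE S (\<lambda>_. T). g (f(j := k)))"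
  unfolding PiE_insert_eq
  by (subst sum.reindex[OF inj_combinator[OF assms]])
    (simp add: sum.cartesian_product case_prod_unfold)

definition iter_pderiv :: "('j \<Rightarrow> 'v) \<Rightarrow> 'j list \<Rightarrow> ('v, 'a::comm_semiring_1) mpoly \<Rightarrow> ('v, 'a) mpoly"
  where "iter_pderiv f js = foldr (\<lambda>j. mpoly_pderiv (f j)) js"

lemma iter_pderiv_Nil [simp]: "iter_pderiv f [] p = p"
  by (simp add: iter_pderiv_def)

lemma iter_pderiv_Cons [simp]:
  "iter_pderiv f (j # js) p = mpoly_pderiv (f j) (iter_pderiv f js p)"
  by (simp add: iter_pderiv_def)

lemma iter_pderiv_upd [simp]:
  "j \<notin> set js \<Longrightarrow> iter_pderiv (f(j := k)) js p = iter_pderiv f js p"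
  by (induction js) auto

lemma homogeneous_iter_pderiv:
  assumes "homogeneous e p" "length js \<le> e"
  shows "homogeneous (e - length js) (iter_pderiv f js p)"
  using assms(2)
proof (induction js)
  case (Cons j js)
  then have "homogeneous (Suc (e - length (j # js))) (iter_pderiv f js p)"
    by (simp add: Suc_diff_Suc)
  then show ?case by (simp add: homogeneous_pderiv)
qed (use assms in auto)

context coeff_hom
begin

text \<open>
  The outermost derivative acts on a form of degree \<open>e - length js\<close>, the remaining ones having
  lowered the degree, so each application of Euler's identity contributes one factor of the
  falling factorial \<open>e (e - 1) (e - 2) \<dots>\<close>.
\<close>

lemma iterated_euler:
  fixes p :: "('n::finite, 'a) mpoly"
  assumes "homogeneous e p" "distinct js" "length js \<le> e"
  shows "(\<Sum>f\<in>set js \<rightarrow>\<^sub>E UNIV. (\<Prod>j\<in>set js. V (f j)) * mpoly_eval V (iter_pderiv f js p)) =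
    of_nat (\<Prod>i = 0..<length js. e - i) * mpoly_eval V p"
  using assms(2,3)
proof (induction js)
  case (Cons j js)
  let ?F = "set js \<rightarrow>\<^sub>E (UNIV :: 'n set)"
  have j: "j \<notin> set js" using Cons.prems by simp
  have "(\<Sum>f\<in>set (j # js) \<rightarrow>\<^sub>E UNIV.
        (\<Prod>j\<in>set (j # js). V (f j)) * mpoly_eval V (iter_pderiv f (j # js) p)) =
      (\<Sum>k\<in>UNIV. \<Sum>f\<in>?F. V k * (\<Prod>i\<in>set js. V ((f(j := k)) i)) *
        mpoly_eval V (mpoly_pderiv k (iter_pderiv f js p)))"
    using j by (simp add: sum_PiE_insert)
  also have "\<dots> = (\<Sum>k\<in>UNIV. \<Sum>f\<in>?F. (\<Prod>i\<in>set js. V (f i)) *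
        (V k * mpoly_eval V (mpoly_pderiv k (iter_pderiv f js p))))"
  proof -
    have "(\<Prod>i\<in>set js. V ((f(j := k)) i)) = (\<Prod>i\<in>set js. V (f i))" for f k
      using j by (intro prod.cong) auto
    then show ?thesis by (simp add: mult_ac)
  qed
  also have "\<dots> = (\<Sum>f\<in>?F. (\<Prod>i\<in>set js. V (f i)) *
        (\<Sum>k\<in>UNIV. V k * mpoly_eval V (mpoly_pderiv k (iter_pderiv f js p))))"
    unfolding sum_distrib_left by (rule sum.swap)
  also have "\<dots> = of_nat (e - length js) *
      (\<Sum>f\<in>?F. (\<Prod>i\<in>set js. V (f i)) * mpoly_eval V (iter_pderiv f js p))"
  proof -
    have "(\<Sum>k\<in>UNIV. V k * mpoly_eval V (mpoly_pderiv k (iter_pderiv f js p))) =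
        of_nat (e - length js) * mpoly_eval V (iter_pderiv f js p)" for f
      using Cons.prems assms(1) by (intro euler homogeneous_iter_pderiv) auto
    then show ?thesis by (simp add: sum_distrib_left mult_ac)
  qed
  also have "\<dots> = of_nat (e - length js) *
      (of_nat (\<Prod>i = 0..<length js. e - i) * mpoly_eval V p)"
    using Cons by simp
  also have "\<dots> = of_nat (\<Prod>i = 0..<length (j # js). e - i) * mpoly_eval V p"
    by (simp add: mult_ac)
  finally show ?case .
qed simp

end

text \<open>
  Differentiating a form of degree \<open>d\<close> exactly \<open>d\<close> times leaves a constant; evaluating at the
  exponent \<open>0\<close> reads it off. Divided by \<open>d!\<close>, these numbers are the entries of the symmetric tensor that
  represents \<open>h\<close>.
\<close>

definition polar_coeff :: "nat \<Rightarrow> ('n, complex) mpoly \<Rightarrow> (nat \<Rightarrow> 'n) \<Rightarrow> complex"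
  where "polar_coeff d h f = Poly_Mapping.lookup (iter_pderiv f [1..<Suc d] h) 0 / fact d"

lemma iter_pderiv_full:
  assumes "homogeneous d h"
  shows "iter_pderiv f [1..<Suc d] h = mpoly_const (fact d * polar_coeff d h f)"
  using homogeneous_0_const homogeneous_iter_pderiv[OF assms, of "[1..<Suc d]" f]
  by (auto simp: polar_coeff_def)

text \<open>
  For \<open>length js = d\<close> the falling factorial in the iterated Euler identity is \<open>d!\<close>. It is
  invertible in the coefficients, and its inverse is carried into the target ring by \<open>\<phi>\<close>; the
  target ring itself need not be a field.
\<close>

lemma eval_homogeneous_polar:
  fixes \<phi> :: "complex \<Rightarrow> 'r::comm_ring_1" and h :: "('n::finite, complex) mpoly"
  assumes "coeff_hom \<phi>" "homogeneous d h"
  shows "coeff_hom.mpoly_eval \<phi> V h =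
    (\<Sum>f\<in>{1..d} \<rightarrow>\<^sub>E UNIV. \<phi> (polar_coeff d h f) * (\<Prod>j\<in>{1..d}. V (f j)))"
proof -
  interpret coeff_hom \<phi> by fact
  have set: "set [1..<Suc d] = {1..d}" by auto
  have "(\<Sum>f\<in>{1..d} \<rightarrow>\<^sub>E UNIV. (\<Prod>j\<in>{1..d}. V (f j)) * \<phi> (fact d * polar_coeff d h f)) =
      of_nat (fact d) * mpoly_eval V h"
    using iterated_euler[OF assms(2), of "[1..<Suc d]" V]
    unfolding set iter_pderiv_full[OF assms(2)] eval_const
    by (simp add: fact_prod_rev del: upt_Suc)
  then have "of_nat (fact d) * mpoly_eval V h = of_nat (fact d) *
      (\<Sum>f\<in>{1..d} \<rightarrow>\<^sub>E UNIV. \<phi> (polar_coeff d h f) * (\<Prod>j\<in>{1..d}. V (f j)))"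
    using hom_of_nat[of "fact d"] by (simp add: hom_mult sum_distrib_left mult_ac)
  then have "\<phi> (1 / fact d) * (\<phi> (fact d) * mpoly_eval V h) = \<phi> (1 / fact d) * (\<phi> (fact d) *
      (\<Sum>f\<in>{1..d} \<rightarrow>\<^sub>E UNIV. \<phi> (polar_coeff d h f) * (\<Prod>j\<in>{1..d}. V (f j))))"
    using hom_of_nat[of "fact d"] by simp
  then show ?thesis
    unfolding mult.assoc[symmetric] hom_mult[symmetric] by (simp add: hom_1)
qed

text \<open>
  Renaming each variable \<open>z\<^sub>k\<close> to itself inside the larger set of variables \<open>z, U\<close> commutes with
  differentiation: both sides are derivations along the renaming that agree on constants and
  variables.
\<close>

lemma mpoly_pderiv_rename:
  fixes h :: "('n, 'a::comm_ring_1) mpoly"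
  shows "mpoly_pderiv (Z k) (mpoly_subst (\<lambda>k. mpoly_var (Z k)) h) =
    mpoly_subst (\<lambda>k. mpoly_var (Z k)) (mpoly_pderiv k h)"
  by (induction h rule: mpoly_ring_induct)
    (simp_all add: subst.eval_add subst.eval_mult mpoly_pderiv_add mpoly_pderiv_mult mpoly_pderiv_var)

text \<open>
  The formal variables \<open>U\<close> pass through every \<open>z\<close>-derivative as constants, so the operators
  expand like a product of sums. Each new operator supplies the value of \<open>f\<close> at one new index.
\<close>

lemma foldr_dir_deriv:
  fixes h :: "('n::finite, complex) mpoly"
  assumes "distinct js"
  shows "foldr dir_deriv js (mpoly_subst (\<lambda>k. mpoly_var (Z k)) h) =
    (\<Sum>f\<in>set js \<rightarrow>\<^sub>E UNIV. (\<Prod>j\<in>set js. mpoly_var (U j (f j))) *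
      mpoly_subst (\<lambda>k. mpoly_var (Z k)) (iter_pderiv f js h))"
  using assms
proof (induction js)
  case (Cons j js)
  let ?ren = "mpoly_subst (\<lambda>k. mpoly_var (Z k)) :: ('n, complex) mpoly \<Rightarrow> _"
  have j: "j \<notin> set js" using Cons.prems by simp
  have d: "mpoly_pderiv (Z k) ((\<Prod>j\<in>set js. mpoly_var (U j (f j))) * ?ren q) =
      (\<Prod>j\<in>set js. mpoly_var (U j (f j))) * ?ren (mpoly_pderiv k q)" for k f q
    by (simp add: mpoly_pderiv_mult mpoly_pderiv_const_prod mpoly_pderiv_var mpoly_pderiv_rename)
  have upd: "(\<Prod>i\<in>set js. mpoly_var (U i ((f(j := k)) i))) =
      (\<Prod>i\<in>set js. mpoly_var (U i (f i)) :: ('n bvar, complex) mpoly)" for f k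
    using j by (intro prod.cong) auto
  have IH: "foldr dir_deriv js (?ren h) = (\<Sum>f\<in>set js \<rightarrow>\<^sub>E UNIV.
      (\<Prod>j\<in>set js. mpoly_var (U j (f j))) * ?ren (iter_pderiv f js h))"
    using Cons by simp
  have "foldr dir_deriv (j # js) (?ren h) =
      (\<Sum>k\<in>UNIV. \<Sum>f\<in>set js \<rightarrow>\<^sub>E UNIV. mpoly_var (U j k) *
        ((\<Prod>j\<in>set js. mpoly_var (U j (f j))) * ?ren (mpoly_pderiv k (iter_pderiv f js h))))"
    unfolding foldr.simps o_apply IH dir_deriv_def mpoly_pderiv_sum d sum_distrib_left by (rule refl)
  also have "\<dots> = (\<Sum>f\<in>set (j # js) \<rightarrow>\<^sub>E UNIV. (\<Prod>j\<in>set (j # js). mpoly_var (U j (f j))) *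
      ?ren (iter_pderiv f (j # js) h))"
    using j by (simp add: sum_PiE_insert upd mult_ac del: fun_upd_apply)
      (simp add: mult_ac)
  finally show ?case .
qed simp

lemma multilin_form_expansion:
  assumes "homogeneous d (H i)"
  shows "multilin_form d H V i =
    (\<Sum>f\<in>{1..d} \<rightarrow>\<^sub>E UNIV. mpoly_const (polar_coeff d (H i) f) * (\<Prod>j\<in>{1..d}. V j (f j)))"
proof -
  have set: "set [1..<Suc d] = {1..d}" by auto
  have "multilin_form d H V i = (\<Sum>f\<in>{1..d} \<rightarrow>\<^sub>E UNIV.
      mpoly_const (1 / fact d) * ((\<Prod>j\<in>{1..d}. V j (f j)) *
        mpoly_const (fact d * polar_coeff d (H i) f)))"
    unfolding multilin_form_def polarization_def foldr_dir_deriv[OF distinct_upt] set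
      iter_pderiv_full[OF assms]
    by (simp add: subst.eval_mult subst.eval_sum subst.eval_prod sum_distrib_left del: upt_Suc)
  also have "\<dots> = (\<Sum>f\<in>{1..d} \<rightarrow>\<^sub>E UNIV.
      mpoly_const (1 / fact d * (fact d * polar_coeff d (H i) f)) * (\<Prod>j\<in>{1..d}. V j (f j)))"
    by (simp only: mpoly_const_mult mult_ac)
  finally show ?thesis by simp
qed

lemma multilin_form_cong:
  assumes "homogeneous d (H i)" "\<And>j. j \<in> {1..d} \<Longrightarrow> V j = W j"
  shows "multilin_form d H V i = multilin_form d H W i"
  unfolding multilin_form_expansion[where H = H and i = i, OF assms(1)]
  using assms(2) by simp

text \<open>
  On the diagonal the polar form and the form itself have the same expansion.
\<close>

lemma multilin_form_diagonal:
  assumes "homogeneous d (H i)"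
  shows "multilin_form d H (\<lambda>_. V) i = mpoly_subst V (H i)"
  using eval_homogeneous_polar[OF coeff_hom_const assms, of V]
  unfolding multilin_form_expansion[where H = H and i = i, OF assms] subst_eval by simp

lemma homogeneous_multilin_form:
  assumes "homogeneous d (H i)" "\<And>j v. j \<in> {1..d} \<Longrightarrow> homogeneous (e j) (V j v)"
  shows "homogeneous (\<Sum>j=1..d. e j) (multilin_form d H V i)"
  unfolding multilin_form_expansion[where H = H and i = i, OF assms(1)]
proof (rule homogeneous_sum)
  fix f :: "nat \<Rightarrow> 'a"
  have "homogeneous (\<Sum>j=1..d. e j) (\<Prod>j\<in>{1..d}. V j (f j))"
    using assms(2) by (intro homogeneous_prod) auto
  from homogeneous_mult[OF homogeneous_const this]
  show "homogeneous (\<Sum>j=1..d. e j)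
      (mpoly_const (polar_coeff d (H i) f) * (\<Prod>j\<in>{1..d}. V j (f j)))"
    by simp
qed

lemma multilin_form_sum:
  assumes "homogeneous d (H i)" "finite S"
  shows "multilin_form d H (\<lambda>_ v. \<Sum>m\<in>S. N m v) i =
    (\<Sum>k\<in>{1..d} \<rightarrow>\<^sub>E S. multilin_form d H (\<lambda>j. N (k j)) i)"
  unfolding multilin_form_expansion[where H = H and i = i, OF assms(1)]
  unfolding prod_sum_PiE[OF finite_atLeastAtMost assms(2)] sum_distrib_left by (rule sum.swap)

section \<open>Polynomials as power series\<close>

lemma nth_of_mpoly [simp]: "mfps_nth (mfps_of_mpoly p) a = Poly_Mapping.lookup p a"
  by (simp add: mfps_of_mpoly_def Abs_mfps_inverse)

lemmas nth_simps [simp] = zero_mfps.rep_eq one_mfps.rep_eq plus_mfps.rep_eq minus_mfps.rep_eq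

lemma nth_sum: "mfps_nth (\<Sum>x\<in>S. f x) a = (\<Sum>x\<in>S. mfps_nth (f x) a)"
  by (induction S rule: infinite_finite_induct) auto

lemma nth_const_mult [simp]:
  fixes f :: "('v, 'a::comm_ring_1) mfps"
  shows "mfps_nth (mfps_of_mpoly (mpoly_const x) * f) a = x * mfps_nth f a"
proof -
  have "mfps_nth (mfps_of_mpoly (mpoly_const x) * f) a =
      (\<Sum>(b, c) | b + c = a. (if b = 0 then x else 0) * mfps_nth f c)"
    unfolding times_mfps.rep_eq
    by (intro sum.cong) (auto simp: mpoly_const_def lookup_single when_def)
  also have "\<dots> = (\<Sum>(b, c)\<in>{(0 :: 'v monom, a)}. (if b = 0 then x else 0) * mfps_nth f c)"
    by (rule sum.mono_neutral_right) (auto split: if_splits simp: case_prod_unfold)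
  finally show ?thesis by simp
qed

lemma of_mpoly_add: "mfps_of_mpoly (p + q) = mfps_of_mpoly p + mfps_of_mpoly q"
  by (rule mfps_eqI) (simp add: lookup_add)

lemma of_mpoly_diff: "mfps_of_mpoly (p - q) = mfps_of_mpoly p - mfps_of_mpoly q"
  by (rule mfps_eqI) (simp add: lookup_minus)

lemma of_mpoly_1: "mfps_of_mpoly 1 = 1"
  by (rule mfps_eqI) (simp add: lookup_one when_def)

text \<open>
  For two single terms the convolution sum has at most one nonzero summand, the splitting into
  the exponents of the two terms.
\<close>

lemma of_mpoly_mult:
  fixes p q :: "('v, 'a::comm_ring_1) mpoly"
  shows "mfps_of_mpoly (p * q) = mfps_of_mpoly p * mfps_of_mpoly q"
proof (induction p rule: mpoly_sum_induct)
  case (single a c)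
  show ?case
  proof (induction q rule: mpoly_sum_induct)
    case (single b c')
    show ?case
    proof (rule mfps_eqI)
      fix x
      let ?f = "\<lambda>(k, l). Poly_Mapping.lookup (Poly_Mapping.single a c) k *
        Poly_Mapping.lookup (Poly_Mapping.single b c') l"
      have "(\<Sum>y | fst y + snd y = x. ?f y) = (\<Sum>y | y = (a, b) \<and> a + b = x. ?f y)"
        by (rule sum.mono_neutral_right) (auto simp: lookup_single when_def split: if_splits)
      also have "\<dots> = (if a + b = x then c * c' else 0)"
        by simp
      finally show "mfps_nth (mfps_of_mpoly (Poly_Mapping.single a c * Poly_Mapping.single b c')) x =
          mfps_nth (mfps_of_mpoly (Poly_Mapping.single a c) * mfps_of_mpoly (Poly_Mapping.single b c')) x"
        by (simp add: times_mfps.rep_eq mult_single lookup_single when_def case_prod_unfold)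
    qed
  qed (simp add: distrib_left of_mpoly_add)
qed (simp add: distrib_right of_mpoly_add)

lemma of_mpoly_prod:
  fixes f :: "'j \<Rightarrow> ('v, 'a::comm_ring_1) mpoly"
  shows "mfps_of_mpoly (\<Prod>x\<in>S. f x) = (\<Prod>x\<in>S. mfps_of_mpoly (f x))"
  by (induction S rule: infinite_finite_induct) (auto simp: of_mpoly_1 of_mpoly_mult)

interpretation series: coeff_hom "\<lambda>c :: 'a::comm_ring_1. mfps_of_mpoly (mpoly_const c) :: ('w, 'a) mfps"
  by unfold_locales
    (auto simp: mpoly_const_add mpoly_const_mult mpoly_const_1 of_mpoly_add of_mpoly_mult of_mpoly_1)

lemma compose_of_mpoly: "mfps_compose (mfps_of_mpoly p) g = series.mpoly_eval g p"
proof (rule mfps_eqI)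
  fix c
  have "mfps_nth (mfps_compose (mfps_of_mpoly p) g) c =
      Sum_any (\<lambda>a. Poly_Mapping.lookup p a * mfps_nth (monom_eval g a) c)"
    by (simp add: mfps_compose_def Abs_mfps_inverse)
  also have "\<dots> = (\<Sum>a\<in>Poly_Mapping.keys p. Poly_Mapping.lookup p a * mfps_nth (monom_eval g a) c)"
    by (rule Sum_any.expand_superset) (auto simp: in_keys_iff)
  finally show "mfps_nth (mfps_compose (mfps_of_mpoly p) g) c = mfps_nth (series.mpoly_eval g p) c"
    by (simp add: series.mpoly_eval_def nth_sum)
qed

section \<open>Orders of vanishing\<close>

definition mfps_order_ge :: "nat \<Rightarrow> ('v, 'a::zero) mfps \<Rightarrow> bool"
  where "mfps_order_ge t f \<longleftrightarrow> (\<forall>c. monom_deg c < t \<longrightarrow> mfps_nth f c = 0)"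

lemma order_ge_add: "mfps_order_ge t f \<Longrightarrow> mfps_order_ge t g \<Longrightarrow> mfps_order_ge t (f + g)"
  for f g :: "('v, 'a::comm_ring_1) mfps"
  by (simp add: mfps_order_ge_def)

lemma order_ge_mult:
  fixes f g :: "('v, 'a::comm_ring_1) mfps"
  assumes "mfps_order_ge s f" "mfps_order_ge t g"
  shows "mfps_order_ge (s + t) (f * g)"
  unfolding mfps_order_ge_def times_mfps.rep_eq
proof (intro allI impI sum.neutral, safe)
  fix b c :: "'v monom"
  assume "monom_deg (b + c) < s + t"
  then have "monom_deg b < s \<or> monom_deg c < t" by auto
  then show "mfps_nth f b * mfps_nth g c = 0"
    using assms by (auto simp: mfps_order_ge_def)
qed

lemma order_ge_prod:
  fixes f :: "'j \<Rightarrow> ('v, 'a::comm_ring_1) mfps"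
  assumes "\<And>j. j \<in> J \<Longrightarrow> mfps_order_ge 1 (f j)"
  shows "mfps_order_ge (card J) (\<Prod>j\<in>J. f j)"
  using assms
proof (induction J rule: infinite_finite_induct)
  case (insert x F)
  then show ?case using order_ge_mult[of 1 "f x" "card F"] by auto
qed (auto simp: mfps_order_ge_def)

text \<open>
  Telescoping \<open>x X - y Y = (x - y) X + y (X - Y)\<close> one factor at a time: every summand contains
  one difference, of order at least \<open>t\<close>, and \<open>card J - 1\<close> factors of order at least \<open>1\<close>.
  For empty or infinite \<open>J\<close> the difference is \<open>0\<close>, so the truncated subtraction does no harm.
\<close>

lemma order_ge_prod_diff:
  fixes f g :: "'j \<Rightarrow> ('v, 'a::comm_ring_1) mfps"
  assumes "\<And>j. j \<in> J \<Longrightarrow> mfps_order_ge 1 (f j)" "\<And>j. j \<in> J \<Longrightarrow> mfps_order_ge 1 (g j)"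
    and "\<And>j. j \<in> J \<Longrightarrow> mfps_order_ge t (f j - g j)"
  shows "mfps_order_ge (t + card J - 1) ((\<Prod>j\<in>J. f j) - (\<Prod>j\<in>J. g j))"
  using assms
proof (induction J rule: infinite_finite_induct)
  case (insert x F)
  have "mfps_order_ge (t + card F) ((f x - g x) * (\<Prod>j\<in>F. f j))"
    using insert.prems by (intro order_ge_mult order_ge_prod) auto
  moreover have "mfps_order_ge (1 + (t + card F - 1)) (g x * ((\<Prod>j\<in>F. f j) - (\<Prod>j\<in>F. g j)))"
    using insert by (intro order_ge_mult) auto
  then have "mfps_order_ge (t + card F) (g x * ((\<Prod>j\<in>F. f j) - (\<Prod>j\<in>F. g j)))"
    by (auto simp: mfps_order_ge_def)
  ultimately have "mfps_order_ge (t + card F)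
      ((f x - g x) * (\<Prod>j\<in>F. f j) + g x * ((\<Prod>j\<in>F. f j) - (\<Prod>j\<in>F. g j)))"
    by (rule order_ge_add)
  also have "(f x - g x) * (\<Prod>j\<in>F. f j) + g x * ((\<Prod>j\<in>F. f j) - (\<Prod>j\<in>F. g j)) =
      (\<Prod>j\<in>insert x F. f j) - (\<Prod>j\<in>insert x F. g j)"
    using insert.hyps by (simp add: algebra_simps)
  finally show ?case using insert.hyps by simp
qed (auto simp: mfps_order_ge_def)

section \<open>The recursion for the formal inverse\<close>

lemma formal_inverse_fixed_point:
  assumes "is_formal_inverse (\<lambda>i. mfps_var i - mfps_of_mpoly (H i)) G"
  shows "G i = mfps_var i + series.mpoly_eval G (H i)"
proof -
  have "mfps_var i = mfps_compose (mfps_of_mpoly (mpoly_var i - H i)) G"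
    using assms by (simp add: is_formal_inverse_def mfps_var_def of_mpoly_diff)
  also have "\<dots> = G i - series.mpoly_eval G (H i)"
    by (simp add: compose_of_mpoly series.eval_diff)
  finally show ?thesis by (simp add: algebra_simps)
qed

text \<open>
  The gain of \<open>d - 1\<close> over the order \<open>t\<close> of the error is what makes the fixed point equation a
  recursion for \<open>d \<ge> 2\<close>: the components of \<open>G\<close> up to some degree determine strictly higher ones.
\<close>

lemma eval_truncation:
  fixes h :: "('v::finite, complex) mpoly" and P :: "'v \<Rightarrow> ('w, complex) mpoly"
  assumes "homogeneous d h"
    and "\<And>v. mfps_order_ge 1 (G v)" "\<And>v. mfps_order_ge 1 (mfps_of_mpoly (P v))"
    and "\<And>v. mfps_order_ge t (G v - mfps_of_mpoly (P v))"
    and "monom_deg c < t + d - 1"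
  shows "mfps_nth (series.mpoly_eval G h) c = Poly_Mapping.lookup (mpoly_subst P h) c"
proof -
  have "mfps_nth (\<Prod>j\<in>{1..d}. G (f j)) c = Poly_Mapping.lookup (\<Prod>j\<in>{1..d}. P (f j)) c"
    for f :: "nat \<Rightarrow> 'v"
  proof -
    have "mfps_order_ge (t + card {1..d} - 1)
        ((\<Prod>j\<in>{1..d}. G (f j)) - (\<Prod>j\<in>{1..d}. mfps_of_mpoly (P (f j))))"
      using assms by (intro order_ge_prod_diff) auto
    then show ?thesis using assms(5)
      by (simp add: mfps_order_ge_def flip: of_mpoly_prod)
  qed
  moreover have "Poly_Mapping.lookup (mpoly_const x * p) c = x * Poly_Mapping.lookup p c"
    for x and p :: "('w, complex) mpoly"
    using nth_const_mult[of x "mfps_of_mpoly p" c] by (simp flip: of_mpoly_mult)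
  ultimately show ?thesis
    using eval_homogeneous_polar[OF coeff_hom_const assms(1), of P]
      eval_homogeneous_polar[OF series.coeff_hom_axioms assms(1), of G]
    by (simp add: subst_eval nth_sum lookup_sum)
qed

text \<open>
  In each degree only finitely many summands of \<open>\<Sum>\<^sub>m N\<^sub>m\<close> contribute, because the degrees
  \<open>m (d - 1) + 1\<close> grow strictly with \<open>m\<close>.
\<close>

lemma nth_inverse_truncation:
  fixes N :: "nat \<Rightarrow> 'n::finite \<Rightarrow> ('n, complex) mpoly"
  assumes "d \<ge> 2"
    and "G i = mfps_var i + mfps_suminf (\<lambda>m. mfps_of_mpoly (N (Suc m) i))"
    and "\<And>m. homogeneous (m * (d - 1) + 1) (N m i)"
    and "N 0 i = mpoly_var i"
    and "monom_deg c < Suc M * (d - 1) + 1"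
  shows "mfps_nth (G i) c = (\<Sum>m\<le>M. Poly_Mapping.lookup (N m i) c)"
proof -
  have "Poly_Mapping.lookup (N (Suc m) i) c = 0" if "m \<ge> M" for m
  proof -
    have "Suc M * (d - 1) \<le> Suc m * (d - 1)" using that by (intro mult_right_mono) auto
    then show ?thesis using assms(5) by (intro homogeneous_lookup[OF assms(3)]) linarith
  qed
  then have "Sum_any (\<lambda>m. Poly_Mapping.lookup (N (Suc m) i) c) =
      (\<Sum>m<M. Poly_Mapping.lookup (N (Suc m) i) c)"
    by (intro Sum_any.expand_superset) (auto simp: not_less[symmetric])
  then show ?thesis
    by (simp add: assms(2,4) mfps_suminf_def Abs_mfps_inverse mfps_var_def sum.atMost_shift)
qed

text \<open>
  Both sides are homogeneous of the same degree, so the comparison is made coefficientwise in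
  that degree. Treating \<open>z\<close> as the component \<open>N\<^sub>0\<close> makes the statement uniform in \<open>m \<ge> 0\<close>.
\<close>

lemma inverse_recursion:
  fixes d :: nat
    and H :: "'n::finite \<Rightarrow> ('n, complex) mpoly"
    and G :: "'n \<Rightarrow> ('n, complex) mfps"
    and N :: "nat \<Rightarrow> 'n \<Rightarrow> ('n, complex) mpoly"
  assumes d: "d \<ge> 2"
    and H: "\<And>i. homogeneous d (H i)"
    and inv: "is_formal_inverse (\<lambda>i. mfps_var i - mfps_of_mpoly (H i)) G"
    and G: "\<And>i. G i = mfps_var i + mfps_suminf (\<lambda>m. mfps_of_mpoly (N (Suc m) i))"
    and N_hom: "\<And>m i. homogeneous (m * (d - 1) + 1) (N m i)"
    and N_0: "\<And>i. N 0 i = mpoly_var i"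
  shows "N (Suc m) i =
      (\<Sum>k \<in> {k \<in> {1..d} \<rightarrow>\<^sub>E UNIV. (\<Sum>j=1..d. k j) = m}.
         multilin_form d H (\<lambda>j. N (k j)) i)"
proof -
  let ?e = "\<lambda>m. m * (d - 1) + 1"
  let ?K = "{k \<in> {1..d} \<rightarrow>\<^sub>E UNIV. (\<Sum>j=1..d. k j) = m}"
  let ?B = "\<lambda>k. multilin_form d H (\<lambda>j. N (k j)) i"
  have nth_G: "mfps_nth (G v) c = (\<Sum>k\<le>M. Poly_Mapping.lookup (N k v) c)"
    if "monom_deg c < ?e (Suc M)" for v c M
    using nth_inverse_truncation[where G = G and N = N and i = v, OF d G N_hom N_0 that] .
  have e_inj: "?e k = ?e l \<longleftrightarrow> k = l" for k l
    using d by auto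
  have N_zero: "Poly_Mapping.lookup (N k v) c = 0" if "monom_deg c = ?e l" "k \<noteq> l" for k l v c
  proof (rule homogeneous_lookup[OF N_hom])
    show "monom_deg c \<noteq> ?e k"
      unfolding that(1) e_inj using that(2) by blast
  qed
  have B_hom: "homogeneous (?e (Suc (\<Sum>j=1..d. k j))) (?B k)" for k
  proof -
    have "homogeneous (\<Sum>j=1..d. ?e (k j)) (?B k)"
      using H N_hom by (intro homogeneous_multilin_form) auto
    moreover have "(\<Sum>j=1..d. ?e (k j)) = ?e (Suc (\<Sum>j=1..d. k j))"
    proof -
      have "(\<Sum>j=1..d. ?e (k j)) = (\<Sum>j=1..d. k j) * (d - 1) + d"
        unfolding sum.distrib sum_distrib_right by simp
      then show ?thesis using d by simp
    qed
    ultimately show ?thesis by metis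
  qed
  \<comment> \<open>An index exceeding \<open>m\<close> cannot occur, so truncating at \<open>N\<^sub>m\<close> loses no summand.\<close>
  have K: "?K \<subseteq> {1..d} \<rightarrow>\<^sub>E {..m}"
    by (auto simp: PiE_iff extensional_def intro!: member_le_sum)
  have coeff: "Poly_Mapping.lookup (N (Suc m) i) c = Poly_Mapping.lookup (\<Sum>k\<in>?K. ?B k) c"
    if c: "monom_deg c = ?e (Suc m)" for c
  proof -
    let ?P = "\<lambda>v. \<Sum>k\<le>m. N k v"
    have ord1: "mfps_order_ge 1 (mfps_of_mpoly (?P v))" for v
      unfolding mfps_order_ge_def nth_of_mpoly lookup_sum
      by (auto intro!: sum.neutral homogeneous_lookup[OF N_hom])
    have ord1': "mfps_order_ge 1 (G v)" for v
      using inv by (auto simp: mfps_order_ge_def is_formal_inverse_def)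
    have trunc: "mfps_order_ge (?e (Suc m)) (G v - mfps_of_mpoly (?P v))" for v
      using nth_G by (auto simp: mfps_order_ge_def lookup_sum)
    have "Poly_Mapping.lookup (N (Suc m) i) c = (\<Sum>k\<in>{Suc m}. Poly_Mapping.lookup (N k i) c)"
      by simp
    also have "\<dots> = (\<Sum>k\<le>Suc m. Poly_Mapping.lookup (N k i) c)"
      by (intro sum.mono_neutral_left) (use N_zero[OF c] in auto)
    also have "\<dots> = mfps_nth (G i) c"
      using d c by (intro nth_G[symmetric]) simp
    also have "\<dots> = mfps_nth (series.mpoly_eval G (H i)) c"
    proof -
      have "Poly_Mapping.lookup (mpoly_var i :: ('n, complex) mpoly) c = 0"
        using d c by (intro homogeneous_lookup[OF homogeneous_var]) auto
      then show ?thesis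
        using formal_inverse_fixed_point[OF inv, of i] by (simp add: mfps_var_def)
    qed
    also have "\<dots> = Poly_Mapping.lookup (mpoly_subst ?P (H i)) c"
      using d c by (intro eval_truncation[OF H ord1' ord1 trunc]) simp
    also have "mpoly_subst ?P (H i) = (\<Sum>k\<in>{1..d} \<rightarrow>\<^sub>E {..m}. ?B k)"
      using multilin_form_diagonal[where H = H and i = i and V = ?P, OF H]
        multilin_form_sum[where H = H and i = i and N = N and S = "{..m}", OF H]
      by simp
    also have "Poly_Mapping.lookup \<dots> c = (\<Sum>k\<in>?K. Poly_Mapping.lookup (?B k) c)"
      unfolding lookup_sum
    proof (rule sum.mono_neutral_right)
      show "\<forall>k\<in>({1..d} \<rightarrow>\<^sub>E {..m}) - ?K. Poly_Mapping.lookup (?B k) c = 0"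
      proof
        fix k assume "k \<in> ({1..d} \<rightarrow>\<^sub>E {..m}) - ?K"
        then have "(\<Sum>j=1..d. k j) \<noteq> m" by (auto simp: PiE_iff)
        then show "Poly_Mapping.lookup (?B k) c = 0"
          using c e_inj by (intro homogeneous_lookup[OF B_hom]) (metis Suc_inject)
      qed
    qed (use K in \<open>auto intro: finite_PiE\<close>)
    finally show ?thesis by (simp add: lookup_sum)
  qed
  have sum_hom: "homogeneous (?e (Suc m)) (\<Sum>k\<in>?K. ?B k)"
    using B_hom by (intro homogeneous_sum) auto
  show ?thesis
  proof (rule poly_mapping_eqI)
    fix c
    show "Poly_Mapping.lookup (N (Suc m) i) c = Poly_Mapping.lookup (\<Sum>k\<in>?K. ?B k) c"
    proof (cases "monom_deg c = ?e (Suc m)")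
      case True
      then show ?thesis by (rule coeff)
    next
      case False
      then show ?thesis
        using homogeneous_lookup[OF N_hom False] homogeneous_lookup[OF sum_hom False] by simp
    qed
  qed
qed

theorem theorem4p2:
  fixes d :: nat
    and H :: "'n::finite \<Rightarrow> ('n, complex) mpoly"
    and G :: "'n \<Rightarrow> ('n, complex) mfps"
    and N :: "nat \<Rightarrow> 'n \<Rightarrow> ('n, complex) mpoly"
  assumes d: "d \<ge> 2"
    and H: "\<And>i. homogeneous d (H i)"
    and inv: "is_formal_inverse (\<lambda>i. mfps_var i - mfps_of_mpoly (H i)) G"
    and G: "\<And>i. G i = mfps_var i + mfps_suminf (\<lambda>m. mfps_of_mpoly (N (Suc m) i))"
    and N_hom: "\<And>m i. m \<ge> 1 \<Longrightarrow> homogeneous (m * (d - 1) + 1) (N m i)"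
    and N_0: "\<And>i. N 0 i = mpoly_var i"
  shows "N 1 = H \<and>
    (\<forall>m\<ge>1. \<forall>i. N (m + 1) i =
      (\<Sum>k \<in> {k \<in> {1..d} \<rightarrow>\<^sub>E UNIV. (\<Sum>j=1..d. k j) = m}.
         multilin_form d H (\<lambda>j. N (k j)) i))"
proof -
  have hom: "homogeneous (m * (d - 1) + 1) (N m i)" for m i
    using N_hom[of m i] homogeneous_var N_0 by (cases "m = 0") auto
  note recursion = inverse_recursion[OF d H inv G hom N_0]
  have "N 1 i = H i" for i
  proof -
    \<comment> \<open>For \<open>m = 0\<close> the only admissible index tuple is \<open>(0, \<dots>, 0)\<close>.\<close>
    let ?o = "\<lambda>j\<in>{1..d}. 0 :: nat"
    have "{k \<in> {1..d} \<rightarrow>\<^sub>E UNIV. (\<Sum>j=1..d. k j) = (0 :: nat)} = {?o}"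
      by (auto simp: PiE_iff extensional_def fun_eq_iff)
    then have "N 1 i = multilin_form d H (\<lambda>j. N (?o j)) i"
      using recursion[of 0 i] by simp
    also have "\<dots> = multilin_form d H (\<lambda>_. mpoly_var) i"
      using H N_0 by (intro multilin_form_cong) (auto simp: fun_eq_iff)
    also have "\<dots> = H i"
      using H by (simp add: multilin_form_diagonal)
    finally show ?thesis .
  qed
  then show ?thesis using recursion by (auto simp: fun_eq_iff)
qed

end
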